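(* Let $H$ be a complex Hilbert space, let $K\in B(H)$ be a bounded operator, and let $A$ be an unbounded self-adjoint positive operator in $H$ with domain $D(A)$ such that $K^*A\subseteq AK$. Then \[|\langle AKx,x\rangle|\leq r(K)\,\langle Ax,x\rangle\quad\text{for all }x\in D(A),\] where $r(K)$ denotes the spectral radius of $K$.
   Context: $B(H)$ denotes the bounded (everywhere defined) linear operators on $H$. "Unbounded operator" means a linear operator defined on a linear subspace of $H$, not necessarily bounded. Products have their natural domains: $D(K^*A)=D(A)$ and $D(AK)=\{x\in H: Kx\in D(A)\}$. For operators $S,T$, $S\subseteq T$ means $D(S)\subseteq D(T)$ and $Sx=Tx$ for all $x\in D(S)$. A self-adjoint operator $A$ is positive if $\langle Ax,x\rangle\geq 0$ for all $x\in D(A)$. *)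

theory Defs
  imports "HOL-Analysis.Analysis"
begin

class complex_vector = real_vector +
  fixes scaleC :: "complex \<Rightarrow> 'a \<Rightarrow> 'a" (infixr "*\<^sub>C" 75)
  assumes scaleR_scaleC: "r *\<^sub>R x = complex_of_real r *\<^sub>C x"
    and scaleC_add_right: "c *\<^sub>C (x + y) = c *\<^sub>C x + c *\<^sub>C y"
    and scaleC_add_left: "(c + d) *\<^sub>C x = c *\<^sub>C x + d *\<^sub>C x"
    and scaleC_scaleC: "c *\<^sub>C d *\<^sub>C x = (c * d) *\<^sub>C x"
    and scaleC_one: "1 *\<^sub>C x = x"

text \<open>Inner products are linear in the first argument.\<close>

class complex_inner = complex_vector + real_normed_vector +
  fixes cinner :: "'a \<Rightarrow> 'a \<Rightarrow> complex"
  assumes cinner_commute: "cinner x y = cnj (cinner y x)"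
    and cinner_add_left: "cinner (x + y) z = cinner x z + cinner y z"
    and cinner_scaleC_left: "cinner (c *\<^sub>C x) y = c * cinner x y"
    and cinner_self_nonneg: "cinner x x \<in> \<real>\<^sub>\<ge>\<^sub>0"
    and cinner_eq_zero_iff: "cinner x x = 0 \<longleftrightarrow> x = 0"
    and norm_eq_sqrt_cinner: "norm x = sqrt (Re (cinner x x))"

class complex_hilbert_space = complex_inner + banach

definition bounded_clinear :: "('a::complex_inner \<Rightarrow> 'a) \<Rightarrow> bool" where
  "bounded_clinear K \<longleftrightarrow> bounded_linear K \<and> (\<forall>c x. K (c *\<^sub>C x) = c *\<^sub>C K x)"

definition spectrum :: "('a::complex_inner \<Rightarrow> 'a) \<Rightarrow> complex set" where
  "spectrum K = {z. \<not> (\<exists>R. bounded_clinear R \<and>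
     (\<forall>x. R (K x - z *\<^sub>C x) = x) \<and> (\<forall>x. K (R x) - z *\<^sub>C R x = x))}"

text \<open>On the zero space the spectrum is empty and the supremum is an unspecified real number.\<close>

definition spectral_radius :: "('a::complex_inner \<Rightarrow> 'a) \<Rightarrow> real" where
  "spectral_radius K = (SUP z\<in>spectrum K. cmod z)"

text \<open>
  An unbounded operator is a partial map whose domain \<open>dom T\<close> is the domain of the operator.
  Thus \<open>S \<subseteq>\<^sub>m T\<close> says that \<open>T\<close> extends \<open>S\<close>, and \<open>S \<circ>\<^sub>m T\<close> is the product with its natural domain.
\<close>

definition linear_operator :: "('a::complex_inner \<rightharpoonup> 'a) \<Rightarrow> bool" where
  "linear_operator T \<longleftrightarrow> T 0 = Some 0 \<and>
     (\<forall>x y u v. T x = Some u \<longrightarrow> T y = Some v \<longrightarrow> T (x + y) = Some (u + v)) \<and>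
     (\<forall>c x u. T x = Some u \<longrightarrow> T (c *\<^sub>C x) = Some (c *\<^sub>C u))"

abbreviation everywhere :: "('a \<Rightarrow> 'a) \<Rightarrow> ('a \<rightharpoonup> 'a)" where
  "everywhere K \<equiv> (\<lambda>x. Some (K x))"

text \<open>Only meaningful if \<open>dom T\<close> is dense, which makes the vector \<open>z\<close> below unique.\<close>

definition op_adjoint :: "('a::complex_inner \<rightharpoonup> 'a) \<Rightarrow> ('a \<rightharpoonup> 'a)" where
  "op_adjoint T y =
    (if \<exists>z. \<forall>x\<in>dom T. cinner (the (T x)) y = cinner x z
     then Some (THE z. \<forall>x\<in>dom T. cinner (the (T x)) y = cinner x z)
     else None)"

definition self_adjoint :: "('a::complex_inner \<rightharpoonup> 'a) \<Rightarrow> bool" where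
  "self_adjoint A \<longleftrightarrow> linear_operator A \<and> closure (dom A) = UNIV \<and> op_adjoint A = A"

definition positive_operator :: "('a::complex_inner \<rightharpoonup> 'a) \<Rightarrow> bool" where
  "positive_operator A \<longleftrightarrow> (\<forall>x\<in>dom A. cinner (the (A x)) x \<in> \<real>\<^sub>\<ge>\<^sub>0)"

end

theory Submission
  imports Defs "HOL-Complex_Analysis.Complex_Analysis"
begin

text \<open>
  The hypothesis makes \<open>K\<close> symmetric for the semi-inner product \<open>B u v = \<langle>A u, v\<rangle>\<close> on \<open>D(A)\<close>.
  Hence \<open>b\<^sub>n = B (K\<^sup>n x) (K\<^sup>n x) = \<langle>A x, K\<^sup>2\<^sup>n x\<rangle>\<close> is log-convex by the Cauchy--Schwarz inequality.
  For fixed \<open>x\<close> and \<open>\<rho> > r(K)\<close> it is \<open>O(\<rho>\<^sup>2\<^sup>n)\<close>, because \<open>\<langle>K\<^sup>n x, A x\<rangle>\<close> are the Taylor coefficients of a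
  matrix element of \<open>(I - u K)\<^sup>-\<^sup>1\<close>. So \<open>b\<^sub>1 \<le> \<rho>\<^sup>2 b\<^sub>0\<close>, and
  \<open>\<bar>B (K x) x\<bar>\<^sup>2 \<le> b\<^sub>1 b\<^sub>0 \<le> \<rho>\<^sup>2 b\<^sub>0\<^sup>2\<close>. That \<open>r(K)\<close> is a genuine nonnegative number rests on the
  spectrum being bounded (Neumann series) and nonempty (Liouville), and that \<open>K\<^sup>*\<close> is everywhere
  defined on Riesz' theorem.
\<close>

section \<open>Positive semidefinite forms and the inner product\<close>

text \<open>Positivity of \<open>B w w\<close> for \<open>w = x + c *\<^sub>C y\<close> with
  \<open>c = t * B x y\<close>, \<open>t\<close> real, is a quadratic inequality in
  \<open>t\<close>. The set \<open>D\<close> is explicit because the lemma serves both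
  \<open>cinner\<close> on the whole space and the form of \<open>A\<close>, which lives on
  \<open>dom A\<close> only.\<close>

lemma semidefinite_form_Cauchy_Schwarz:
  fixes B :: "'a::complex_vector \<Rightarrow> 'a \<Rightarrow> complex"
  assumes add: "\<And>x y. x \<in> D \<Longrightarrow> y \<in> D \<Longrightarrow> x + y \<in> D"
    and scale: "\<And>c x. x \<in> D \<Longrightarrow> c *\<^sub>C x \<in> D"
    and B_add: "\<And>x y z. x \<in> D \<Longrightarrow> y \<in> D \<Longrightarrow> z \<in> D \<Longrightarrow> B (x + y) z = B x z + B y z"
    and B_scale: "\<And>c x z. x \<in> D \<Longrightarrow> z \<in> D \<Longrightarrow> B (c *\<^sub>C x) z = c * B x z"
    and B_herm: "\<And>x y. x \<in> D \<Longrightarrow> y \<in> D \<Longrightarrow> B x y = cnj (B y x)"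
    and B_pos: "\<And>x. x \<in> D \<Longrightarrow> 0 \<le> Re (B x x)"
    and x: "x \<in> D" and y: "y \<in> D"
  shows "(cmod (B x y))\<^sup>2 \<le> Re (B x x) * Re (B y y)"
proof -
  define p q b where "p = Re (B x x)" and "q = Re (B y y)" and "b = B x y"
  have Bxx: "B x x = of_real p" and Byy: "B y y = of_real q"
    using B_herm[OF x x] B_herm[OF y y] by (auto simp: p_def q_def complex_eq_iff)
  have Byx: "B y x = cnj b"
    using B_herm[OF y x] by (simp add: b_def)
  have pos: "0 \<le> p + (2 * t + t\<^sup>2 * q) * (cmod b)\<^sup>2" for t :: real
  proof -
    \<comment> \<open>The factor \<open>b\<close> aligns the phases, so that both cross terms become
      the real number \<open>t * (cmod b)\<^sup>2\<close>.\<close>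
    define c where "c = of_real t * b"
    define w where "w = x + c *\<^sub>C y"
    have w: "w \<in> D"
      using x y add scale by (simp add: w_def)
    have left: "B w z = B x z + c * B y z" if "z \<in> D" for z
      using that x y scale by (simp add: w_def B_add B_scale)
    have right: "B z w = B z x + cnj c * B z y" if "z \<in> D" for z
      using that w x y left[OF that] B_herm[of z w] B_herm[of z x] B_herm[of z y] by simp
    have "B w w = of_real p + cnj c * b + c * (cnj b + cnj c * of_real q)"
      using left[OF w] right[OF x] right[OF y] by (simp add: Bxx Byy Byx b_def)
    also have "\<dots> = of_real p + of_real (2 * t + t\<^sup>2 * q) * (b * cnj b)"
      by (simp add: c_def power2_eq_square algebra_simps)
    also have "\<dots> = of_real (p + (2 * t + t\<^sup>2 * q) * (cmod b)\<^sup>2)"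
      by (simp add: complex_norm_square[symmetric])
    finally show ?thesis
      using B_pos[OF w] by simp
  qed
  have "0 \<le> q"
    using B_pos[OF y] by (simp add: q_def)
  show ?thesis
  proof (cases "q = 0")
    case True
    have "p + 2 * t * (cmod b)\<^sup>2 \<ge> 0" for t
      using pos[of t] True by simp
    \<comment> \<open>If \<open>b\<close> were nonzero, this value of \<open>t\<close> would make
      the left side equal to -1.\<close>
    from this[of "- (p + 1) / (2 * (cmod b)\<^sup>2)"] have "b = 0"
      by (cases "b = 0") (auto simp: field_simps)
    then show ?thesis
      using True by (simp add: b_def q_def)
  next
    case False
    with \<open>0 \<le> q\<close> have "q > 0" by simp
    \<comment> \<open>The value \<open>t = - 1 / q\<close> minimises
      \<open>2 * t + t\<^sup>2 * q\<close>.\<close>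
    have "(2 * (- 1 / q) + (- 1 / q)\<^sup>2 * q) = - 1 / q"
      using \<open>q > 0\<close> by (simp add: field_simps power2_eq_square)
    with pos[of "- 1 / q"] have "0 \<le> p - (cmod b)\<^sup>2 / q"
      by simp
    then have "(cmod b)\<^sup>2 \<le> p * q"
      using \<open>q > 0\<close> by (simp add: field_simps)
    then show ?thesis
      by (simp add: b_def p_def q_def)
  qed
qed

section \<open>Elementary rules for complex scalars, the inner product and the norm\<close>

lemma scaleC_zero_left [simp]: "0 *\<^sub>C (x::'a::complex_vector) = 0"
  using scaleR_scaleC[of 0 x] by simp

lemma scaleC_minus_one [simp]: "(- 1) *\<^sub>C (x::'a::complex_vector) = - x"
  using scaleR_scaleC[of "- 1" x] by simp

lemma scaleC_minus_left: "(- c) *\<^sub>C (x::'a::complex_vector) = - (c *\<^sub>C x)"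
  using scaleC_scaleC[of "- 1" c x] by simp

lemma scaleC_minus_right: "c *\<^sub>C (- x::'a::complex_vector) = - (c *\<^sub>C x)"
  using scaleC_scaleC[of c "- 1" x] scaleC_minus_left[of c x] by simp

lemma scaleC_diff_left: "(c - d) *\<^sub>C (x::'a::complex_vector) = c *\<^sub>C x - d *\<^sub>C x"
  using scaleC_add_left[of c "- d" x] by (simp add: scaleC_minus_left)

lemma scaleC_diff_right: "c *\<^sub>C (x - y::'a::complex_vector) = c *\<^sub>C x - c *\<^sub>C y"
  using scaleC_add_right[of c x "- y"] by (simp add: scaleC_minus_right)

lemma cinner_add_right: "cinner x (y + z) = cinner x y + cinner x z"
  by (metis cinner_add_left cinner_commute complex_cnj_add)

lemma cinner_scaleC_right: "cinner x (c *\<^sub>C y) = cnj c * cinner x y"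
  by (metis cinner_commute cinner_scaleC_left complex_cnj_mult)

lemma cinner_zero_left [simp]: "cinner 0 y = 0"
  using cinner_add_left[of 0 0 y] by simp

lemma cinner_zero_right [simp]: "cinner x 0 = 0"
  using cinner_add_right[of x 0 0] by simp

lemma cinner_minus_left: "cinner (- x) y = - cinner x y"
  using cinner_scaleC_left[of "- 1" x y] by simp

lemma cinner_minus_right: "cinner x (- y) = - cinner x y"
  using cinner_scaleC_right[of x "- 1" y] by simp

lemma cinner_diff_left: "cinner (x - y) z = cinner x z - cinner y z"
  using cinner_add_left[of x "- y" z] by (simp add: cinner_minus_left)

lemma cinner_diff_right: "cinner x (y - z) = cinner x y - cinner x z"
  using cinner_add_right[of x y "- z"] by (simp add: cinner_minus_right)

lemma Re_cinner_self: "Re (cinner x x) = (norm x)\<^sup>2"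
proof -
  have "0 \<le> Re (cinner x x)"
    using cinner_self_nonneg[of x] by (auto simp: nonneg_Reals_def)
  then show ?thesis
    by (simp add: norm_eq_sqrt_cinner)
qed

lemma norm_cinner_le: "cmod (cinner x y) \<le> norm x * norm y"
proof -
  have "(cmod (cinner x y))\<^sup>2 \<le> Re (cinner x x) * Re (cinner y y)"
    by (rule semidefinite_form_Cauchy_Schwarz[where D = UNIV])
       (auto simp: cinner_add_left cinner_scaleC_left Re_cinner_self intro: cinner_commute)
  then have "(cmod (cinner x y))\<^sup>2 \<le> (norm x * norm y)\<^sup>2"
    by (simp add: Re_cinner_self power_mult_distrib)
  then show ?thesis
    by (rule power2_le_imp_le) simp
qed

lemma norm_scaleC: "norm (c *\<^sub>C x) = cmod c * norm (x::'a::complex_inner)"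
proof -
  have "(norm (c *\<^sub>C x))\<^sup>2 = Re ((c * cnj c) * cinner x x)"
    by (simp only: Re_cinner_self[symmetric] cinner_scaleC_left cinner_scaleC_right mult_ac)
  also have "\<dots> = (cmod c * norm x)\<^sup>2"
    by (simp add: complex_norm_square[symmetric] Re_cinner_self power_mult_distrib del: of_real_power)
  finally show ?thesis
    by (simp add: power2_eq_iff_nonneg)
qed

lemma bounded_linear_cinner_left: "bounded_linear (\<lambda>x. cinner x y)"
proof (rule bounded_linear_intro)
  show "cmod (cinner x y) \<le> norm x * norm y" for x
    by (rule norm_cinner_le)
qed (simp_all add: cinner_add_left cinner_scaleC_left scaleR_scaleC scaleR_conv_of_real)

section \<open>The Riesz representation theorem and adjoints\<close>

lemma parallelogram_law:
  fixes x y :: "'a::complex_inner"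
  shows "(norm (x + y))\<^sup>2 + (norm (x - y))\<^sup>2 = 2 * (norm x)\<^sup>2 + 2 * (norm y)\<^sup>2"
  by (simp add: Re_cinner_self[symmetric] cinner_add_left cinner_add_right
      cinner_diff_left cinner_diff_right)

lemma norm_add_square:
  fixes x y :: "'a::complex_inner"
  shows "(norm (x + y))\<^sup>2 = (norm x)\<^sup>2 + 2 * Re (cinner x y) + (norm y)\<^sup>2"
  using arg_cong[OF cinner_commute[of y x], of Re]
  by (simp add: Re_cinner_self[symmetric] cinner_add_left cinner_add_right)

text \<open>First-order condition for a minimum: in \<open>Riesz_real\<close> the polynomial is the
  increment of the functional along a line through its minimiser.\<close>

lemma quadratic_nonneg_linear_coeff_0:
  fixes a b :: real
  assumes "\<And>t. 0 \<le> t\<^sup>2 * a + t * b"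
  shows "b = 0"
proof (rule ccontr)
  assume "b \<noteq> 0"
  have "a \<ge> 0"
    using assms[of 1] assms[of "-1"] by simp
  \<comment> \<open>The denominator is \<open>a + 1\<close> rather than \<open>a\<close>, so that it
    stays positive when \<open>a = 0\<close>.\<close>
  have "0 \<le> (- b / (a + 1))\<^sup>2 * a + (- b / (a + 1)) * b"
    by (rule assms)
  also have "\<dots> = - (b / (a + 1))\<^sup>2"
    using \<open>a \<ge> 0\<close> by (simp add: power2_eq_square divide_simps) (simp add: algebra_simps)
  finally show False
    using \<open>a \<ge> 0\<close> \<open>b \<noteq> 0\<close> by simp
qed

text \<open>
  The representing vector minimises \<open>\<lambda>v. (norm v)\<^sup>2 - 2 * f v\<close>; by the parallelogram law
  minimising sequences are Cauchy.
\<close>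

lemma Riesz_real:
  fixes f :: "'a::complex_hilbert_space \<Rightarrow> real"
  assumes f: "bounded_linear f"
  shows "\<exists>z. \<forall>v. f v = Re (cinner v z)"
proof -
  interpret f: bounded_linear f by (rule f)
  obtain M where M: "\<And>v. norm (f v) \<le> norm v * M"
    using f.bounded by blast
  define J where "J v = (norm v)\<^sup>2 - 2 * f v" for v
  define m where "m = (INF v. J v)"
  \<comment> \<open>Completing the square: \<open>J v\<close> is at least
    \<open>(norm v - M)\<^sup>2 - M\<^sup>2\<close>.\<close>
  have J_ge: "- (M\<^sup>2) \<le> J v" for v
  proof -
    have "f v \<le> norm v * M"
      using M[of v] by simp
    moreover have "0 \<le> (norm v - M)\<^sup>2" by simp
    ultimately show ?thesis
      unfolding J_def power2_diff by simp
  qed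
  have bdd: "bdd_below (range J)"
    using J_ge by (intro bdd_belowI2)
  have m_le: "m \<le> J v" for v
    unfolding m_def using bdd by (rule cINF_lower) simp
  have "\<exists>v. J v < m + 1 / real (Suc n)" for n
    using cINF_less_iff[OF _ bdd, of "m + 1 / real (Suc n)"] by (simp add: m_def)
  then obtain v where v: "\<And>n. J (v n) < m + 1 / real (Suc n)"
    by metis
  \<comment> \<open>The midpoint of \<open>a\<close> and \<open>b\<close> cannot have a value below
    \<open>m\<close>; the parallelogram law turns this into a bound on the distance of two
    near-minimisers.\<close>
  have dist: "(norm (a - b))\<^sup>2 \<le> 2 * (J a - m) + 2 * (J b - m)" for a b
  proof -
    have "m \<le> J ((1/2) *\<^sub>R (a + b))" by (rule m_le)
    also have "\<dots> = (norm (a + b))\<^sup>2 / 4 - f a - f b"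
      by (simp add: J_def f.scaleR f.add power_divide add_divide_distrib)
    finally show ?thesis
      using parallelogram_law[of a b] by (simp add: J_def)
  qed
  have "Cauchy v"
    unfolding Cauchy_iff
  proof (intro allI impI)
    fix e :: real assume e: "0 < e"
    obtain N where N: "1 / real (Suc N) < e\<^sup>2 / 4"
      using reals_Archimedean[of "e\<^sup>2 / 4"] e by (auto simp: inverse_eq_divide)
    have small: "J (v n) - m < e\<^sup>2 / 4" if "n \<ge> N" for n
    proof -
      have "1 / real (Suc n) \<le> 1 / real (Suc N)"
        using that by (intro divide_left_mono) auto
      then show ?thesis using v[of n] N by linarith
    qed
    have "norm (v i - v j) < e" if "i \<ge> N" "j \<ge> N" for i j
    proof -
      have "(norm (v i - v j))\<^sup>2 < e\<^sup>2"
        using dist[of "v i" "v j"] small[OF that(1)] small[OF that(2)] by argo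
      then show ?thesis using e by (simp add: power2_less_imp_less)
    qed
    then show "\<exists>N. \<forall>i\<ge>N. \<forall>j\<ge>N. norm (v i - v j) < e" by blast
  qed
  then obtain z where z: "v \<longlonglongrightarrow> z"
    using Cauchy_convergent convergentD by blast
  have "(\<lambda>n. J (v n)) \<longlonglongrightarrow> J z"
    unfolding J_def by (intro tendsto_intros z f.tendsto)
  moreover have "(\<lambda>n. m + 1 / real (Suc n)) \<longlonglongrightarrow> m + 0"
    by (intro tendsto_intros) real_asymp
  ultimately have Jz: "J z \<le> m"
    using v by (intro LIMSEQ_le[of "\<lambda>n. J (v n)"]) (auto intro: less_imp_le)
  have "f u = Re (cinner u z)" for u
  proof -
    \<comment> \<open>By continuity of \<open>J\<close> the limit \<open>z\<close> is a minimiser,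
      so no move from \<open>z\<close> in the direction \<open>u\<close> lowers
      \<open>J\<close>.\<close>
    have "0 \<le> t\<^sup>2 * (norm u)\<^sup>2 + t * (2 * Re (cinner z u) - 2 * f u)" for t
    proof -
      have "J z \<le> J (z + t *\<^sub>R u)"
        using Jz m_le order_trans by blast
      also have "\<dots> = J z + t\<^sup>2 * (norm u)\<^sup>2 + t * (2 * Re (cinner z u) - 2 * f u)"
        using cinner_scaleC_right[of z "of_real t" u]
        by (simp add: J_def norm_add_square f.add f.scaleR power_mult_distrib
            scaleR_scaleC[symmetric] right_diff_distrib)
      finally show ?thesis by simp
    qed
    then have "2 * Re (cinner z u) - 2 * f u = 0"
      by (rule quadratic_nonneg_linear_coeff_0)
    then show ?thesis
      using arg_cong[OF cinner_commute[of z u], of Re] by simp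
  qed
  then show ?thesis by blast
qed

text \<open>A complex-linear functional is determined by its real part, since
  \<open>Re (\<phi> (\<i> *\<^sub>C v)) = - Im (\<phi> v)\<close>; the same holds for
  \<open>cinner\<close> in its first argument.\<close>

lemma Riesz:
  fixes \<phi> :: "'a::complex_hilbert_space \<Rightarrow> complex"
  assumes \<phi>: "bounded_linear \<phi>" and scale: "\<And>c x. \<phi> (c *\<^sub>C x) = c * \<phi> x"
  shows "\<exists>z. \<forall>v. \<phi> v = cinner v z"
proof -
  obtain z where z: "\<And>v. Re (\<phi> v) = Re (cinner v z)"
    using Riesz_real[OF bounded_linear_compose[OF bounded_linear_Re \<phi>]] by blast
  have "Im (\<phi> v) = Im (cinner v z)" for v
    using z[of "\<i> *\<^sub>C v"] by (simp add: scale cinner_scaleC_left)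
  with z show ?thesis
    by (auto simp: complex_eq_iff)
qed

text \<open>Riesz provides the vector for every \<open>y\<close>. It is unique, as the difference of
  two candidates is orthogonal to itself, so the description operator in \<open>op_adjoint\<close>
  picks it.\<close>

lemma op_adjoint_everywhere:
  fixes K :: "'a::complex_hilbert_space \<Rightarrow> 'a"
  assumes K: "bounded_clinear K"
  shows "\<exists>z. op_adjoint (everywhere K) y = Some z \<and> (\<forall>x. cinner (K x) y = cinner x z)"
proof -
  have "bounded_linear (\<lambda>v. cinner (K v) y)"
    using K bounded_linear_compose[OF bounded_linear_cinner_left] by (auto simp: bounded_clinear_def)
  then obtain z where z: "\<And>v. cinner (K v) y = cinner v z"
    using Riesz[of "\<lambda>v. cinner (K v) y"] K
    by (auto simp: bounded_clinear_def cinner_scaleC_left)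
  have unique: "z' = z" if "\<forall>x. cinner (K x) y = cinner x z'" for z'
  proof -
    have "cinner (z' - z) (z' - z) = 0"
      using that z by (simp add: cinner_diff_right)
    then show ?thesis
      by (simp add: cinner_eq_zero_iff)
  qed
  have "(THE z. \<forall>x. cinner (K x) y = cinner x z) = z"
    using z unique by (intro the_equality) auto
  then show ?thesis
    using z by (auto simp: op_adjoint_def dom_def)
qed

text \<open>The equation \<open>op_adjoint A = A\<close> gives \<open>A y\<close> only through a
  description operator. Density of \<open>dom A\<close> supplies uniqueness: a vector orthogonal to
  a dense set is orthogonal to itself.\<close>

lemma self_adjoint_symmetric:
  assumes A: "self_adjoint A" and x: "x \<in> dom A" and y: "y \<in> dom A"
  shows "cinner (the (A x)) y = cinner x (the (A y))"
proof -
  have adj: "op_adjoint A y = A y" and dense: "closure (dom A) = UNIV"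
    using A by (auto simp: self_adjoint_def)
  define P where "P z \<longleftrightarrow> (\<forall>x\<in>dom A. cinner (the (A x)) y = cinner x z)" for z
  have ex: "\<exists>z. P z" and the: "A y = Some (THE z. P z)"
    using y adj by (auto simp: op_adjoint_def P_def split: if_splits)
  have unique: "z' = z" if "P z" "P z'" for z z'
  proof -
    have "closed {x. cinner x (z' - z) = 0}"
      by (intro closed_Collect_eq continuous_intros
          linear_continuous_on bounded_linear_cinner_left)
    moreover have "dom A \<subseteq> {x. cinner x (z' - z) = 0}"
    proof
      fix x assume x: "x \<in> dom A"
      have "cinner x z = cinner x z'"
        using that x unfolding P_def by metis
      then show "x \<in> {x. cinner x (z' - z) = 0}"
        by (simp add: cinner_diff_right)
    qed
    ultimately have "closure (dom A) \<subseteq> {x. cinner x (z' - z) = 0}"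
      by (rule closure_minimal[rotated])
    then have "cinner (z' - z) (z' - z) = 0"
      unfolding dense by blast
    then show ?thesis
      by (simp add: cinner_eq_zero_iff)
  qed
  obtain z where z: "P z"
    using ex by (rule exE)
  then have "P (THE z. P z)"
    by (rule theI) (rule unique[OF z])
  then show ?thesis
    using x by (simp add: P_def the)
qed

section \<open>Neumann series and the resolvent\<close>

lemma bounded_clinear_imp_bounded_linear: "bounded_clinear T \<Longrightarrow> bounded_linear T"
  by (simp add: bounded_clinear_def)

lemma bounded_clinear_add: "bounded_clinear T \<Longrightarrow> T (x + y) = T x + T y"
  by (simp add: bounded_clinear_def linear_add bounded_linear.linear)

lemma bounded_clinear_diff: "bounded_clinear T \<Longrightarrow> T (x - y) = T x - T y"
  by (simp add: bounded_clinear_def linear_diff bounded_linear.linear)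

lemma bounded_clinear_zero: "bounded_clinear T \<Longrightarrow> T 0 = 0"
  by (simp add: bounded_clinear_def linear_0 bounded_linear.linear)

lemma bounded_clinear_scaleC: "bounded_clinear T \<Longrightarrow> T (c *\<^sub>C x) = c *\<^sub>C T x"
  by (simp add: bounded_clinear_def)

lemma bounded_clinear_id: "bounded_clinear (\<lambda>x. x)"
  by (simp add: bounded_clinear_def)

lemma bounded_clinear_compose:
  "bounded_clinear S \<Longrightarrow> bounded_clinear T \<Longrightarrow> bounded_clinear (\<lambda>x. S (T x))"
  by (simp add: bounded_clinear_def bounded_linear_compose)

lemma bounded_clinear_bound:
  assumes "bounded_clinear T"
  obtains M where "M > 0" "\<And>x. norm (T x) \<le> M * norm x"
  using bounded_linear.pos_bounded[of T] assms by (auto simp: bounded_clinear_def mult.commute)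

lemma bounded_clinear_intro:
  assumes "\<And>x y. T (x + y) = T x + T y" "\<And>c x. T (c *\<^sub>C x) = c *\<^sub>C T x"
    and "\<And>x. norm (T x) \<le> M * norm x"
  shows "bounded_clinear T"
  unfolding bounded_clinear_def
  by (intro conjI bounded_linear_intro[where K = M]) (use assms in \<open>simp_all add: scaleR_scaleC mult.commute\<close>)

lemma bounded_clinear_const_scaleC: "bounded_clinear (\<lambda>x. c *\<^sub>C x)"
  by (rule bounded_clinear_intro[where M = "cmod c"])
     (simp_all add: scaleC_add_right scaleC_scaleC mult.commute norm_scaleC)

lemma bounded_clinear_funpow: "bounded_clinear T \<Longrightarrow> bounded_clinear (T ^^ n)"
  by (induction n) (auto simp: bounded_clinear_id id_def o_def intro: bounded_clinear_compose)

text \<open>The condition inside \<open>spectrum\<close>, stated for an arbitrary map, so that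
  \<open>K - z\<close> and \<open>I - u K\<close> can be treated alike.\<close>

definition bounded_inverse :: "('a::complex_inner \<Rightarrow> 'a) \<Rightarrow> ('a \<Rightarrow> 'a) \<Rightarrow> bool" where
  "bounded_inverse T R \<longleftrightarrow> bounded_clinear R \<and> (\<forall>x. R (T x) = x) \<and> (\<forall>x. T (R x) = x)"

lemma inv_eq_bounded_inverse: "bounded_inverse T R \<Longrightarrow> inv T = R"
  by (simp add: bounded_inverse_def inv_equality)

lemma bounded_inverse_scaleC:
  assumes "bounded_inverse T R" "c \<noteq> 0"
  shows "bounded_inverse (\<lambda>x. c *\<^sub>C T x) (\<lambda>x. (1 / c) *\<^sub>C R x)"
proof -
  have R: "bounded_clinear R"
    using assms by (simp add: bounded_inverse_def)
  have "T ((1 / c) *\<^sub>C R x) = (1 / c) *\<^sub>C x" for x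
    using assms(1) bounded_clinear_scaleC[OF R, of "1 / c" x] unfolding bounded_inverse_def by metis
  then show ?thesis
    using assms R
    by (auto simp: bounded_inverse_def bounded_clinear_scaleC scaleC_scaleC scaleC_one
        intro: bounded_clinear_compose[OF bounded_clinear_const_scaleC])
qed

text \<open>The series converges pointwise by comparison with a geometric one. Removing its first
  term shows that \<open>S (T x)\<close> and \<open>T (S x)\<close> both equal
  \<open>S x - x\<close>, which are the two inverse identities.\<close>

lemma Neumann_series:
  fixes T :: "'a::complex_hilbert_space \<Rightarrow> 'a"
  assumes T: "bounded_clinear T" and c: "\<And>x. norm (T x) \<le> c * norm x" "0 \<le> c" "c < 1"
  obtains S where "bounded_inverse (\<lambda>x. x - T x) S" "\<And>x. (\<lambda>n. (T ^^ n) x) sums S x"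
proof -
  have pow: "norm ((T ^^ n) x) \<le> c ^ n * norm x" for n x
  proof (induction n)
    case (Suc n)
    have "norm ((T ^^ Suc n) x) \<le> c * norm ((T ^^ n) x)"
      using c(1) by simp
    also have "\<dots> \<le> c * (c ^ n * norm x)"
      using Suc c(2) by (rule mult_left_mono)
    finally show ?case by simp
  qed simp
  have geo: "(\<lambda>n. c ^ n * norm x) sums (1 / (1 - c) * norm x)" for x
    using c by (intro sums_mult2 geometric_sums) auto
  have summable: "summable (\<lambda>n. (T ^^ n) x)" for x
    using sums_summable[OF geo] pow by (rule summable_comparison_test')
  define S where "S x = (\<Sum>n. (T ^^ n) x)" for x
  have S: "(\<lambda>n. (T ^^ n) x) sums S x" for x
    unfolding S_def using summable by (rule summable_sums)
  have S_eqI: "S x = y" if "(\<lambda>n. (T ^^ n) x) sums y" for x y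
    using S that by (rule sums_unique2)
  have "norm (S x) \<le> 1 / (1 - c) * norm x" for x
  proof -
    have "summable (\<lambda>n. norm ((T ^^ n) x))"
      using sums_summable[OF geo] by (rule summable_comparison_test') (use pow in simp)
    then have "norm (S x) \<le> (\<Sum>n. norm ((T ^^ n) x))"
      unfolding S_def by (rule summable_norm)
    also have "\<dots> \<le> (\<Sum>n. c ^ n * norm x)"
      by (rule suminf_le) (use pow sums_summable[OF geo] \<open>summable (\<lambda>n. norm ((T ^^ n) x))\<close> in auto)
    finally show ?thesis
      by (simp only: sums_unique[OF geo])
  qed
  moreover have S_add: "S (x + y) = S x + S y" for x y
    using sums_add[OF S S, of x y]
    by (intro S_eqI) (simp add: bounded_clinear_add[OF bounded_clinear_funpow[OF T]])
  moreover have S_scale: "S (a *\<^sub>C x) = a *\<^sub>C S x" for a x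
    using bounded_linear.sums[OF bounded_clinear_imp_bounded_linear[OF bounded_clinear_const_scaleC] S]
    by (intro S_eqI) (simp add: bounded_clinear_scaleC[OF bounded_clinear_funpow[OF T]])
  ultimately have bS: "bounded_clinear S"
    by (intro bounded_clinear_intro)
  have shift: "(\<lambda>n. (T ^^ Suc n) x) sums (S x - x)" for x
    using S[of x] sums_Suc_iff[of "\<lambda>n. (T ^^ n) x"] by simp
  have "S (T x) = S x - x" for x
    using shift by (intro S_eqI) (simp only: funpow_swap1[symmetric] funpow.simps o_apply)
  moreover have "T (S x) = S x - x" for x
    using bounded_linear.sums[OF bounded_clinear_imp_bounded_linear[OF T] S[of x]] shift[of x]
    by (intro sums_unique2) simp_all
  ultimately have "bounded_inverse (\<lambda>x. x - T x) S"
    using bS by (simp add: bounded_inverse_def bounded_clinear_diff)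
  then show ?thesis
    using S that by blast
qed

text \<open>\<open>P - z Q = (P - w Q) (I - (z - w) R Q)\<close>, and the second factor is inverted
  by its Neumann series. The pencil covers both \<open>K - z I\<close> and
  \<open>I - u K\<close>.\<close>

lemma pencil_inverse_power_series:
  fixes P Q :: "'a::complex_hilbert_space \<Rightarrow> 'a"
  assumes P: "bounded_clinear P" and Q: "bounded_clinear Q"
    and R: "bounded_inverse (\<lambda>x. P x - w *\<^sub>C Q x) R"
  obtains d where "d > 0"
    and "\<And>z. z \<in> ball w d \<Longrightarrow> \<exists>S. bounded_inverse (\<lambda>x. P x - z *\<^sub>C Q x) S \<and>
      (\<forall>x y. (\<lambda>n. cinner (((\<lambda>v. R (Q v)) ^^ n) (R x)) y * (z - w) ^ n) sums cinner (S x) y)"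
proof -
  define V where "V = (\<lambda>v. R (Q v))"
  have bR: "bounded_clinear R" and left: "R (P x - w *\<^sub>C Q x) = x"
    and right: "P (R x) - w *\<^sub>C Q (R x) = x" for x
    using R by (auto simp: bounded_inverse_def)
  have V: "bounded_clinear V"
    unfolding V_def using bR Q by (rule bounded_clinear_compose)
  obtain M where M: "M > 0" "\<And>x. norm (V x) \<le> M * norm x"
    using bounded_clinear_bound[OF V] by blast
  show thesis
  proof
    \<comment> \<open>Within distance \<open>1 / M\<close> of \<open>w\<close> the map
      \<open>(z - w) R Q\<close> is a strict contraction.\<close>
    show "1 / M > 0"
      using M by simp
    fix z assume "z \<in> ball w (1 / M)"
    then have z: "cmod (z - w) * M < 1"
      using M by (simp add: dist_norm norm_minus_commute field_simps)
    define T where "T = (\<lambda>v. (z - w) *\<^sub>C V v)"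
    have T: "bounded_clinear T"
      unfolding T_def by (rule bounded_clinear_compose[OF bounded_clinear_const_scaleC V])
    have "norm (T x) \<le> (cmod (z - w) * M) * norm x" for x
      using mult_left_mono[OF M(2)[of x], of "cmod (z - w)"] by (simp add: T_def norm_scaleC mult.assoc)
    then obtain N where N: "bounded_inverse (\<lambda>x. x - T x) N" "\<And>x. (\<lambda>n. (T ^^ n) x) sums N x"
      using Neumann_series[OF T, of "cmod (z - w) * M"] z M(1) by auto
    have Tn: "(T ^^ n) x = (z - w) ^ n *\<^sub>C (V ^^ n) x" for n x
      by (induction n) (simp_all add: scaleC_one T_def bounded_clinear_scaleC[OF V] scaleC_scaleC)
    have bN: "bounded_clinear N" and N_left: "N (x - T x) = x" and N_right: "N x - T (N x) = x" for x
      using N(1) by (auto simp: bounded_inverse_def)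
    have factor: "P v - z *\<^sub>C Q v = P (v - T v) - w *\<^sub>C Q (v - T v)" for v
    proof -
      have "P (T v) - w *\<^sub>C Q (T v) = (z - w) *\<^sub>C (P (V v) - w *\<^sub>C Q (V v))"
        by (simp add: T_def bounded_clinear_scaleC[OF P] bounded_clinear_scaleC[OF Q]
            scaleC_diff_right scaleC_scaleC mult.commute)
      also have "\<dots> = (z - w) *\<^sub>C Q v"
        by (simp add: V_def right)
      finally show ?thesis
        by (simp add: bounded_clinear_diff[OF P] bounded_clinear_diff[OF Q]
            scaleC_diff_right scaleC_diff_left algebra_simps)
    qed
    have "bounded_inverse (\<lambda>x. P x - z *\<^sub>C Q x) (\<lambda>x. N (R x))"
      unfolding bounded_inverse_def factor
      by (simp add: bounded_clinear_compose bN bR left right N_left N_right)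
    moreover have "(\<lambda>n. cinner ((V ^^ n) (R x)) y * (z - w) ^ n) sums cinner (N (R x)) y" for x y
      using bounded_linear.sums[OF bounded_linear_cinner_left N(2)[of "R x"], of y]
      by (simp add: Tn cinner_scaleC_left mult.commute)
    ultimately show "\<exists>S. bounded_inverse (\<lambda>x. P x - z *\<^sub>C Q x) S \<and>
      (\<forall>x y. (\<lambda>n. cinner (((\<lambda>v. R (Q v)) ^^ n) (R x)) y * (z - w) ^ n) sums cinner (S x) y)"
      unfolding V_def by blast
  qed
qed

text \<open>Each point of \<open>\<Omega>\<close> has a disc on which the matrix element is a
  convergent power series. Using \<open>inv\<close> makes it a single function of \<open>z\<close>,
  equal to the matrix element of the bounded inverse wherever one exists.\<close>

lemma pencil_inverse_holomorphic:
  fixes P Q :: "'a::complex_hilbert_space \<Rightarrow> 'a"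
  assumes P: "bounded_clinear P" and Q: "bounded_clinear Q"
    and inv: "\<And>z. z \<in> \<Omega> \<Longrightarrow> \<exists>R. bounded_inverse (\<lambda>x. P x - z *\<^sub>C Q x) R"
  shows "(\<lambda>z. cinner (inv (\<lambda>x. P x - z *\<^sub>C Q x) x) y) holomorphic_on \<Omega>"
  unfolding holomorphic_on_def
proof
  fix w assume "w \<in> \<Omega>"
  then obtain R where "bounded_inverse (\<lambda>x. P x - w *\<^sub>C Q x) R"
    using inv by blast
  then obtain d where d: "d > 0"
    "\<And>z. z \<in> ball w d \<Longrightarrow> \<exists>S. bounded_inverse (\<lambda>x. P x - z *\<^sub>C Q x) S \<and>
      (\<forall>x y. (\<lambda>n. cinner (((\<lambda>v. R (Q v)) ^^ n) (R x)) y * (z - w) ^ n) sums cinner (S x) y)"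
    by (rule pencil_inverse_power_series[OF P Q]) (rule that)
  have "(\<lambda>z. cinner (inv (\<lambda>x. P x - z *\<^sub>C Q x) x) y) holomorphic_on ball w d"
  proof (rule power_series_holomorphic)
    fix z assume "z \<in> ball w d"
    then obtain S where S: "bounded_inverse (\<lambda>x. P x - z *\<^sub>C Q x) S"
      "\<And>x y. (\<lambda>n. cinner (((\<lambda>v. R (Q v)) ^^ n) (R x)) y * (z - w) ^ n) sums cinner (S x) y"
      using d(2) by blast
    show "(\<lambda>n. cinner (((\<lambda>v. R (Q v)) ^^ n) (R x)) y * (z - w) ^ n)
        sums cinner (inv (\<lambda>x. P x - z *\<^sub>C Q x) x) y"
      unfolding inv_eq_bounded_inverse[OF S(1)] by (rule S(2))
  qed
  then show "(\<lambda>z. cinner (inv (\<lambda>x. P x - z *\<^sub>C Q x) x) y) field_differentiable at w within \<Omega>"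
    using d(1) holomorphic_on_imp_differentiable_at[of _ "ball w d" w]
    by (auto intro: field_differentiable_at_within)
qed

section \<open>The spectral radius\<close>

lemma not_in_spectrum_iff:
  "z \<notin> spectrum K \<longleftrightarrow> (\<exists>R. bounded_inverse (\<lambda>x. K x - z *\<^sub>C x) R)"
  by (simp add: spectrum_def bounded_inverse_def)

text \<open>\<open>K - z = - z (I - z\<^sup>-\<^sup>1 K)\<close> for \<open>z \<noteq> 0\<close>.\<close>

lemma bounded_inverse_reciprocal:
  assumes R: "bounded_inverse (\<lambda>x. x - u *\<^sub>C K x) R" and "u \<noteq> 0"
  shows "bounded_inverse (\<lambda>x. K x - (1 / u) *\<^sub>C x) (\<lambda>x. (- u) *\<^sub>C R x)"
  using bounded_inverse_scaleC[OF R, of "- 1 / u"] \<open>u \<noteq> 0\<close>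
  by (simp add: scaleC_diff_right scaleC_scaleC scaleC_one scaleC_minus_left)

lemma bounded_inverse_reciprocal':
  assumes R: "bounded_inverse (\<lambda>x. K x - (1 / u) *\<^sub>C x) R" and "u \<noteq> 0"
  shows "bounded_inverse (\<lambda>x. x - u *\<^sub>C K x) (\<lambda>x. (- 1 / u) *\<^sub>C R x)"
  using bounded_inverse_scaleC[OF R, of "- u"] \<open>u \<noteq> 0\<close>
  by (simp add: scaleC_diff_right scaleC_scaleC scaleC_one scaleC_minus_left)

text \<open>The pencil \<open>I - u K\<close> at \<open>u = 0\<close>, where the inverse is the
  identity; this identifies the Taylor coefficients as \<open>cinner ((K ^^ n) x) y\<close>.\<close>

lemma resolvent_power_series_0:
  fixes K :: "'a::complex_hilbert_space \<Rightarrow> 'a"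
  assumes K: "bounded_clinear K"
  obtains d where "d > 0"
    and "\<And>u. cmod u < d \<Longrightarrow> \<exists>S. bounded_inverse (\<lambda>x. x - u *\<^sub>C K x) S \<and>
      (\<forall>x y. (\<lambda>n. cinner ((K ^^ n) x) y * u ^ n) sums cinner (S x) y)"
proof -
  have "bounded_inverse (\<lambda>x. x - 0 *\<^sub>C K x) (\<lambda>x. x)"
    by (simp add: bounded_inverse_def bounded_clinear_id)
  from pencil_inverse_power_series[OF bounded_clinear_id K this] show thesis
    using that by auto
qed

text \<open>If \<open>cmod z\<close> exceeds \<open>1 / d\<close>, then \<open>1 / z\<close> lies in
  the disc where \<open>I - u K\<close> is invertible.\<close>

lemma spectrum_bounded:
  fixes K :: "'a::complex_hilbert_space \<Rightarrow> 'a"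
  assumes K: "bounded_clinear K"
  shows "bdd_above (cmod ` spectrum K)"
proof -
  obtain d where d: "d > 0" "\<And>u. cmod u < d \<Longrightarrow> \<exists>S. bounded_inverse (\<lambda>x. x - u *\<^sub>C K x) S"
    by (rule resolvent_power_series_0[OF K], rule that) blast+
  have "cmod z \<le> 1 / d" if "z \<in> spectrum K" for z
  proof (rule ccontr)
    assume "\<not> cmod z \<le> 1 / d"
    then have z: "1 / d < cmod z" by simp
    then have "z \<noteq> 0"
      using d(1) by (auto simp: field_simps)
    have "cmod (1 / z) < d"
      using z d(1) \<open>z \<noteq> 0\<close> by (simp add: norm_divide field_simps)
    then obtain S where "bounded_inverse (\<lambda>x. x - (1 / z) *\<^sub>C K x) S"
      using d(2) by blast
    then have "z \<notin> spectrum K"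
      using bounded_inverse_reciprocal[of "1 / z" K S] \<open>z \<noteq> 0\<close> not_in_spectrum_iff by auto
    with that show False by simp
  qed
  then show ?thesis
    by (intro bdd_aboveI2)
qed

text \<open>With empty spectrum the matrix elements of the resolvent would be entire and vanish at
  infinity, hence be zero by Liouville. The vector \<open>a\<close> excludes the zero space.\<close>

lemma spectrum_nonempty:
  fixes K :: "'a::complex_hilbert_space \<Rightarrow> 'a" and a :: 'a
  assumes K: "bounded_clinear K" and "a \<noteq> 0"
  shows "spectrum K \<noteq> {}"
proof
  assume empty: "spectrum K = {}"
  define R where "R z = inv (\<lambda>x. K x - z *\<^sub>C x)" for z
  define G where "G u = inv (\<lambda>x. x - u *\<^sub>C K x)" for u
  have inv: "\<exists>R. bounded_inverse (\<lambda>x. K x - z *\<^sub>C x) R" for z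
    using empty not_in_spectrum_iff by blast
  have inv': "\<exists>R. bounded_inverse (\<lambda>x. x - u *\<^sub>C K x) R" for u
  proof (cases "u = 0")
    case True
    then show ?thesis
      using bounded_clinear_id by (auto simp: bounded_inverse_def intro!: exI[of _ "\<lambda>x. x"])
  next
    case False
    then show ?thesis
      using bounded_inverse_reciprocal'[of K u] inv[of "1 / u"] by blast
  qed
  have R: "bounded_inverse (\<lambda>x. K x - z *\<^sub>C x) (R z)" for z
    using inv[of z] inv_eq_bounded_inverse unfolding R_def by metis
  \<comment> \<open>The substitution \<open>u = 1 / z\<close> moves infinity to 0, where
    \<open>G\<close> has continuous matrix elements; the factor \<open>- 1 / z\<close> then gives
    the decay.\<close>
  have RG: "R z x = (- 1 / z) *\<^sub>C G (1 / z) x" if "z \<noteq> 0" for z x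
  proof -
    obtain S where S: "bounded_inverse (\<lambda>x. x - (1 / z) *\<^sub>C K x) S"
      using inv' by blast
    then have "bounded_inverse (\<lambda>x. K x - z *\<^sub>C x) (\<lambda>x. (- (1 / z)) *\<^sub>C S x)"
      using bounded_inverse_reciprocal[OF S] \<open>z \<noteq> 0\<close> by simp
    with S show ?thesis
      by (simp add: R_def G_def inv_eq_bounded_inverse)
  qed
  have "cinner (R 0 x) y = 0" for x y
  proof (rule Liouville_weak_0[of "\<lambda>z. cinner (R z x) y" 0])
    show "(\<lambda>z. cinner (R z x) y) holomorphic_on UNIV"
      unfolding R_def using inv by (intro pencil_inverse_holomorphic K bounded_clinear_id)
    have "(\<lambda>u. cinner (G u x) y) holomorphic_on UNIV"
      unfolding G_def using inv' by (intro pencil_inverse_holomorphic K bounded_clinear_id)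
    then have "isCont (\<lambda>u. cinner (G u x) y) 0"
      by (auto dest!: holomorphic_on_imp_continuous_on simp: continuous_on_eq_continuous_at)
    moreover have inv0: "((\<lambda>z::complex. 1 / z) \<longlongrightarrow> 0) at_infinity"
      using tendsto_inverse_0 by (simp add: inverse_eq_divide[abs_def])
    ultimately have "((\<lambda>z. cinner (G (1 / z) x) y) \<longlongrightarrow> cinner (G 0 x) y) at_infinity"
      by (rule isCont_tendsto_compose)
    then have "((\<lambda>z. - (1 / z) * cinner (G (1 / z) x) y) \<longlongrightarrow> - 0 * cinner (G 0 x) y) at_infinity"
      by (intro tendsto_intros inv0)
    then have "((\<lambda>z. - (1 / z) * cinner (G (1 / z) x) y) \<longlongrightarrow> 0) at_infinity"
      by simp
    moreover have "- (1 / z) * cinner (G (1 / z) x) y = cinner (R z x) y" if "1 \<le> norm z" for z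
      using that RG[of z x] by (force simp: cinner_scaleC_left)
    then have "\<forall>\<^sub>F z in at_infinity. - (1 / z) * cinner (G (1 / z) x) y = cinner (R z x) y"
      unfolding eventually_at_infinity by blast
    ultimately show "((\<lambda>z. cinner (R z x) y) \<longlongrightarrow> 0) at_infinity"
      by (rule Lim_transform_eventually)
  qed
  then have "R 0 a = 0"
    using cinner_eq_zero_iff by blast
  \<comment> \<open>\<open>R 0\<close> is a right inverse of \<open>K\<close>, so
    \<open>a = K (R 0 a) = K 0\<close>.\<close>
  then have "a = 0"
    using R[of 0] bounded_clinear_zero[OF K] by (metis bounded_inverse_def scaleC_zero_left diff_0_right)
  with \<open>a \<noteq> 0\<close> show False by simp
qed

lemma not_in_spectrum_of_norm_gt:
  fixes K :: "'a::complex_hilbert_space \<Rightarrow> 'a"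
  assumes "bounded_clinear K" "spectral_radius K < cmod z"
  shows "z \<notin> spectrum K"
  using assms cSUP_upper[OF _ spectrum_bounded, of z K] by (auto simp: spectral_radius_def)

lemma spectral_radius_nonneg:
  fixes K :: "'a::complex_hilbert_space \<Rightarrow> 'a" and a :: 'a
  assumes K: "bounded_clinear K" and "a \<noteq> 0"
  shows "0 \<le> spectral_radius K"
proof -
  obtain z where "z \<in> spectrum K"
    using spectrum_nonempty[OF assms] by blast
  then show ?thesis
    using not_in_spectrum_of_norm_gt[OF K, of z] norm_ge_zero[of z] by linarith
qed

text \<open>
  This weak form of Gelfand's formula, with \<open>C\<close> depending on \<open>x\<close> and \<open>y\<close>, needs no
  uniform boundedness principle.
\<close>

lemma cinner_funpow_bound:
  fixes K :: "'a::complex_hilbert_space \<Rightarrow> 'a"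
  assumes K: "bounded_clinear K" and \<rho>: "0 \<le> spectral_radius K" "spectral_radius K < \<rho>"
  obtains C where "\<And>n. cmod (cinner ((K ^^ n) x) y) \<le> C * \<rho> ^ n"
proof -
  define f where "f u = cinner (inv (\<lambda>x. x - u *\<^sub>C K x) x) y" for u
  \<comment> \<open>The intermediate \<open>\<sigma>\<close> puts \<open>1 / \<rho>\<close> strictly
    inside an open disc on which \<open>f\<close> is holomorphic.\<close>
  obtain \<sigma> where \<sigma>: "spectral_radius K < \<sigma>" "\<sigma> < \<rho>"
    using dense[OF \<rho>(2)] by blast
  have pos: "0 < \<sigma>" "0 < \<rho>"
    using \<rho> \<sigma> by auto
  obtain d where d: "d > 0"
    "\<And>u. cmod u < d \<Longrightarrow> \<exists>S. bounded_inverse (\<lambda>x. x - u *\<^sub>C K x) S \<and>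
      (\<forall>x y. (\<lambda>n. cinner ((K ^^ n) x) y * u ^ n) sums cinner (S x) y)"
    by (rule resolvent_power_series_0[OF K]) (rule that)
  have "\<exists>R. bounded_inverse (\<lambda>x. x - u *\<^sub>C K x) R" if "u \<in> ball 0 (1 / \<sigma>)" for u
  proof (cases "u = 0")
    case True
    then show ?thesis
      using d(1) d(2)[of u] by auto
  next
    case False
    then have "\<sigma> < 1 / cmod u"
      using that pos by (simp add: field_simps)
    then have "spectral_radius K < cmod (1 / u)"
      using \<sigma> by (simp add: norm_divide)
    then have "\<exists>R. bounded_inverse (\<lambda>x. K x - (1 / u) *\<^sub>C x) R"
      using not_in_spectrum_of_norm_gt[OF K] not_in_spectrum_iff by blast
    then show ?thesis
      using bounded_inverse_reciprocal'[of K u] False by blast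
  qed
  then have hol: "f holomorphic_on ball 0 (1 / \<sigma>)"
    unfolding f_def by (intro pencil_inverse_holomorphic K bounded_clinear_id)
  \<comment> \<open>Near 0 the Neumann series gives the Taylor coefficients of
    \<open>f\<close>.\<close>
  have "\<forall>\<^sub>F u in nhds 0. (\<lambda>n. cinner ((K ^^ n) x) y * u ^ n) sums f u"
    unfolding eventually_nhds_metric f_def using d inv_eq_bounded_inverse
    by (intro exI[of _ d]) fastforce
  then have "f has_fps_expansion Abs_fps (\<lambda>n. cinner ((K ^^ n) x) y)"
    by (intro has_fps_expansionI) simp
  moreover have "f holomorphic_on eball 0 (ereal (1 / \<sigma>))"
    using hol by simp
  moreover have "ereal (norm (of_real (1 / \<rho>) :: complex)) < ereal (1 / \<sigma>)"
    using pos \<sigma> by (simp add: norm_divide field_simps)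
  \<comment> \<open>The Taylor series of \<open>f\<close> converges on the whole disc of holomorphy,
    possibly beyond the radius \<open>d\<close>; its terms at \<open>1 / \<rho>\<close> are
    therefore bounded.\<close>
  ultimately have "(\<lambda>n. fps_nth (Abs_fps (\<lambda>n. cinner ((K ^^ n) x) y)) n * of_real (1 / \<rho>) ^ n)
      sums f (of_real (1 / \<rho>))"
    by (rule has_fps_expansion_imp_sums_complex)
  then have "(\<lambda>n. cinner ((K ^^ n) x) y * of_real (1 / \<rho>) ^ n) \<longlonglongrightarrow> 0"
    by (intro summable_LIMSEQ_zero sums_summable) simp
  then have "Bseq (\<lambda>n. cinner ((K ^^ n) x) y * of_real (1 / \<rho>) ^ n)"
    by (intro convergent_imp_Bseq convergentI)
  then obtain C where C: "\<And>n. cmod (cinner ((K ^^ n) x) y * of_real (1 / \<rho>) ^ n) \<le> C"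
    by (auto simp: Bseq_def)
  have "cmod (cinner ((K ^^ n) x) y) \<le> C * \<rho> ^ n" for n
    using C[of n] pos by (simp add: norm_mult norm_power norm_divide power_divide field_simps)
  then show ?thesis
    by (rule that)
qed

text \<open>The successive ratios of a log-convex sequence do not decrease. A first ratio above
  \<open>q\<close> would force geometric growth at a rate above \<open>q\<close>, against the
  bound.\<close>

lemma log_convex_first_ratio_le:
  fixes b :: "nat \<Rightarrow> real"
  assumes nonneg: "\<And>n. 0 \<le> b n"
    and log_convex: "\<And>n. (b (Suc n))\<^sup>2 \<le> b n * b (Suc (Suc n))"
    and growth: "\<And>n. b n \<le> C * q ^ n" and q: "0 < q"
  shows "b 1 \<le> q * b 0"
proof (rule ccontr)
  assume "\<not> b 1 \<le> q * b 0"
  then have less: "q * b 0 < b 1" by simp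
  have "b 0 \<noteq> 0"
    using log_convex[of 0] less by auto
  then have b0: "0 < b 0"
    using nonneg[of 0] by simp
  define t where "t = b 1 / b 0"
  have t: "q < t"
    using less b0 by (simp add: t_def field_simps)
  \<comment> \<open>Positivity is part of the induction because the step cancels the factor
    \<open>b n\<close>.\<close>
  have step: "0 < b n \<and> t * b n \<le> b (Suc n)" for n
  proof (induction n)
    case 0
    show ?case using b0 by (simp add: t_def)
  next
    case (Suc n)
    have "0 < t * b n" using Suc t q by simp
    then have pos: "0 < b (Suc n)" using Suc by linarith
    have "b n * (t * b (Suc n)) \<le> b (Suc n) * b (Suc n)"
      using mult_right_mono[of "t * b n" "b (Suc n)" "b (Suc n)"] Suc pos by (simp add: mult_ac)
    also have "\<dots> \<le> b n * b (Suc (Suc n))"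
      using log_convex[of n] by (simp add: power2_eq_square)
    finally show ?case
      using Suc pos by (simp add: mult_le_cancel_left_pos)
  qed
  have lower: "t ^ n * b 0 \<le> b n" for n
  proof (induction n)
    case (Suc n)
    have "t ^ Suc n * b 0 = t * (t ^ n * b 0)" by simp
    also have "\<dots> \<le> t * b n"
      using Suc t q by (intro mult_left_mono) auto
    also have "\<dots> \<le> b (Suc n)"
      using step by blast
    finally show ?case .
  qed simp
  have "1 < t / q"
    using t q by simp
  then obtain n where n: "C / b 0 < (t / q) ^ n"
    using real_arch_pow by blast
  have "t ^ n * b 0 \<le> C * q ^ n"
    using lower growth order_trans by blast
  then have "(t / q) ^ n \<le> C / b 0"
    using q b0 by (simp add: power_divide field_simps)
  with n show False by simp
qed

section \<open>The spectral radius bound for the form of \<open>A\<close>\<close>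

theorem theorem3p5:
  fixes K :: "'a::complex_hilbert_space \<Rightarrow> 'a" and A :: "'a \<rightharpoonup> 'a"
  assumes "bounded_clinear K"
    and "self_adjoint A" and "positive_operator A"
    and "op_adjoint (everywhere K) \<circ>\<^sub>m A \<subseteq>\<^sub>m A \<circ>\<^sub>m everywhere K"
  shows "\<forall>x\<in>dom A. cmod (cinner (the ((A \<circ>\<^sub>m everywhere K) x)) x)
           \<le> spectral_radius K * Re (cinner (the (A x)) x)"
proof
  fix x assume x: "x \<in> dom A"
  note K = assms(1)
  define D where "D = dom A"
  define B where "B u v = cinner (the (A u)) v" for u v
  have lin: "linear_operator A"
    using assms(2) by (simp add: self_adjoint_def)
  have D_add: "u + v \<in> D" and B_add: "B (u + v) w = B u w + B v w"
    if "u \<in> D" "v \<in> D" for u v w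
    using that lin unfolding linear_operator_def D_def B_def dom_def
    by (auto simp: cinner_add_left)
  have D_scale: "c *\<^sub>C u \<in> D" and B_scale: "B (c *\<^sub>C u) w = c * B u w" if "u \<in> D" for c u w
    using that lin unfolding linear_operator_def D_def B_def dom_def
    by (auto simp: cinner_scaleC_left)
  have B_herm: "B u v = cnj (B v u)" if "u \<in> D" "v \<in> D" for u v
    using that self_adjoint_symmetric[OF assms(2), of u v] cinner_commute
    unfolding B_def D_def by metis
  have B_pos: "0 \<le> Re (B u u)" if "u \<in> D" for u
    using assms(3) that by (auto simp: positive_operator_def B_def D_def complex_nonneg_Reals_iff)
  have CS: "(cmod (B u v))\<^sup>2 \<le> Re (B u u) * Re (B v v)" if "u \<in> D" "v \<in> D" for u v
    using D_add D_scale B_add B_scale B_herm B_pos that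
    by (rule semidefinite_form_Cauchy_Schwarz[where D = D])
  \<comment> \<open>As \<open>op_adjoint (everywhere K)\<close> is total, its product with
    \<open>A\<close> has domain \<open>D\<close>. The inclusion thus maps \<open>D\<close> into
    itself under \<open>K\<close> and makes \<open>K\<close> symmetric for \<open>B\<close>.\<close>
  have D_K: "K u \<in> D" and B_K: "B (K u) v = B u (K v)" if u: "u \<in> D" for u v
  proof -
    obtain a where a: "A u = Some a"
      using u by (auto simp: D_def)
    obtain z where z: "op_adjoint (everywhere K) a = Some z" "\<And>v. cinner (K v) a = cinner v z"
      using op_adjoint_everywhere[OF K] by blast
    have "(op_adjoint (everywhere K) \<circ>\<^sub>m A) u = Some z"
      using a z(1) by simp
    then have "(A \<circ>\<^sub>m everywhere K) u = Some z"
      using assms(4) unfolding map_le_def by (metis domI)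
    then have AK: "A (K u) = Some z" by simp
    then show "K u \<in> D"
      by (auto simp: D_def)
    show "B (K u) v = B u (K v)"
      using z(2)[of v] AK a cinner_commute unfolding B_def by (metis option.sel)
  qed
  have D_pow: "(K ^^ n) x \<in> D" for n
    by (induction n) (use x D_K D_def in auto)
  have B_pow: "B ((K ^^ n) x) v = B x ((K ^^ n) v)" for n v
    by (induction n arbitrary: v) (simp_all add: B_K[OF D_pow] funpow_swap1[symmetric])
  define b where "b n = Re (B ((K ^^ n) x) ((K ^^ n) x))" for n
  have b_nonneg: "0 \<le> b n" for n
    unfolding b_def by (rule B_pos[OF D_pow])
  have log_convex: "(b (Suc n))\<^sup>2 \<le> b n * b (Suc (Suc n))" for n
  proof -
    \<comment> \<open>Symmetry moves one factor \<open>K\<close> from the left argument to the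
      right, so that Cauchy-Schwarz pairs the powers \<open>n\<close> and
      \<open>n + 2\<close>.\<close>
    have "b (Suc n) = Re (B ((K ^^ n) x) ((K ^^ Suc (Suc n)) x))"
      using B_K[OF D_pow[of n]] by (simp add: b_def)
    then have "(b (Suc n))\<^sup>2 \<le> (cmod (B ((K ^^ n) x) ((K ^^ Suc (Suc n)) x)))\<^sup>2"
      by (metis abs_Re_le_cmod abs_ge_zero power2_abs power_mono)
    also have "\<dots> \<le> b n * b (Suc (Suc n))"
      unfolding b_def by (rule CS[OF D_pow D_pow])
    finally show ?thesis .
  qed
  have CS1: "(cmod (B (K x) x))\<^sup>2 \<le> b 1 * b 0"
    using CS[OF D_K, of x x] x by (simp add: b_def D_def)
  have "cmod (B (K x) x) \<le> spectral_radius K * b 0"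
  \<comment> \<open>If \<open>b 0 = 0\<close>, then \<open>CS1\<close> makes both sides zero
    whatever value \<open>spectral_radius K\<close> has; this includes the zero space. Otherwise
    \<open>x\<close> is nonzero and the radius is a genuine supremum.\<close>
  proof (cases "b 0 = 0")
    case True
    then show ?thesis
      using CS1 by simp
  next
    case False
    then have b0: "0 < b 0"
      using b_nonneg[of 0] by simp
    have "x \<noteq> 0"
      using False by (auto simp: b_def B_def)
    then have r: "0 \<le> spectral_radius K"
      using spectral_radius_nonneg[OF K] by blast
    have "cmod (B (K x) x) \<le> \<rho> * b 0" if \<rho>: "spectral_radius K < \<rho>" for \<rho>
    proof -
      obtain C where C: "\<And>n. cmod (cinner ((K ^^ n) x) (the (A x))) \<le> C * \<rho> ^ n"
        using cinner_funpow_bound[OF K r \<rho>] by blast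
      have "b n \<le> C * (\<rho>\<^sup>2) ^ n" for n
      proof -
        \<comment> \<open>All powers are moved to the right argument; conjugation then yields the
          matrix element with \<open>y = A x\<close>.\<close>
        have "b n = Re (B x ((K ^^ (2 * n)) x))"
          unfolding b_def B_pow by (simp add: mult_2 funpow_add)
        also have "\<dots> \<le> cmod (cinner ((K ^^ (2 * n)) x) (the (A x)))"
          unfolding B_def by (metis cinner_commute complex_Re_le_cmod complex_mod_cnj)
        also have "\<dots> \<le> C * (\<rho>\<^sup>2) ^ n"
          using C[of "2 * n"] by (simp add: power_mult)
        finally show ?thesis .
      qed
      \<comment> \<open>The growth rate is \<open>\<rho>\<^sup>2\<close> because \<open>b n\<close>
        involves the power \<open>2 * n\<close> of \<open>K\<close>.\<close>
      then have "b 1 \<le> \<rho>\<^sup>2 * b 0"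
        using r \<rho> by (intro log_convex_first_ratio_le[where b = b, OF b_nonneg log_convex]) auto
      then have "b 1 * b 0 \<le> (\<rho> * b 0)\<^sup>2"
        using b0 by (simp add: power2_eq_square mult_ac mult_le_cancel_left_pos)
      with CS1 have "(cmod (B (K x) x))\<^sup>2 \<le> (\<rho> * b 0)\<^sup>2"
        by (rule order_trans)
      then show ?thesis
        by (rule power2_le_imp_le) (use r \<rho> b0 in simp)
    qed
    then have "cmod (B (K x) x) / b 0 \<le> \<rho>" if "spectral_radius K < \<rho>" for \<rho>
      using that b0 by (simp add: field_simps)
    \<comment> \<open>The bound holds for every \<open>\<rho>\<close> above the spectral radius,
      hence for the radius itself.\<close>
    then have "cmod (B (K x) x) / b 0 \<le> spectral_radius K"
      by (rule dense_ge)
    then show ?thesis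
      using b0 by (simp add: field_simps)
  qed
  then show "cmod (cinner (the ((A \<circ>\<^sub>m everywhere K) x)) x)
      \<le> spectral_radius K * Re (cinner (the (A x)) x)"
    by (simp add: B_def b_def)
qed

end
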